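(* Let $(\mathbb{X},d)$ be a complete separable metric space with a locally finite Borel measure $\mu$ such that for every $x\in\mathbb{X}$ the pushforward $\mu_x$ of $\mu$ under $y\mapsto d(y,x)$ is absolutely continuous with respect to Lebesgue measure on $[0,\infty)$. Let $\phi$ be a repulsive, tempered potential and suppose that $(\mathbb{X},\mu,d,\phi)$ is homogeneous. Let $\gamma_1$ be the damping function identically equal to $1$. Then: (1) for all $\lambda\ge0$ there is an infinite-depth tree recursion adapted to $\lambda,\gamma_1$; (2) for $\lambda\in[0,e/C_\phi)$ the infinite-depth tree recursion adapted to $\lambda,\gamma_1$ is unique; (3) for $\lambda>e/C_\phi$ the infinite-depth tree recursion adapted to $\lambda,\gamma_1$ is not unique.
   Context: A potential is a measurable symmetric function $\phi:\mathbb{X}\times\mathbb{X}\to(-\infty,\infty]$; it is repulsive if $\phi\ge0$, and tempered if $C_\phi:=\sup_{v\in\mathbb{X}}\int_{\mathbb{X}}|1-e^{-\phi(x,v)}|\,d\mu(x)<\infty$. Locally finite means finite on bounded Borel sets. Conventions: $e^{-\infty}=0$, $e/0=+\infty$. $(\mathbb{X},\mu,d,\phi)$ is homogeneous if for every pair $x,y\in\mathbb{X}$ there is a bijection $g:\mathbb{X}\to\mathbb{X}$ with $g(x)=y$ that preserves the metric $d$, the measure $\mu$, and the potential $\phi$. A damping function is a measurable function $\gamma:\bigcup_{k\ge1}\mathbb{X}^k\to[0,1]$ with $\gamma(v)=1$ for all $v\in\mathbb{X}$ and $\gamma(v_0,\dots,v_\ell)\le\gamma(v_1,\dots,v_\ell)$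 for all $\ell\ge1$. An infinite-depth tree recursion adapted to $\lambda\ge0$ (a constant activity) and a damping function $\gamma$ is a measurable function $\pi:\bigcup_{k\ge1}\mathbb{X}^k\to[0,\infty)$ such that for all $j\ge0$ and $\mu^{j+1}$-almost all $(v_0,\dots,v_j)\in\mathbb{X}^{j+1}$, $$\pi(v_0,\dots,v_j)=\lambda\,\gamma(v_0,\dots,v_j)\exp\Big(-\int_{\mathbb{X}}(1-e^{-\phi(v_j,w)})\,\pi(v_0,\dots,v_j,w)\,d\mu(w)\Big).$$ Two tree recursions are regarded as equal if they agree on almost all tuples of each size. *)

theory Defs
  imports "HOL-Analysis.Analysis"
begin

definition locally_finite :: "'a::metric_space measure \<Rightarrow> bool" where
  "locally_finite M \<longleftrightarrow> (\<forall>B\<in>sets borel. bounded B \<longrightarrow> emeasure M B < \<infinity>)"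

(* exp (- u) for u in (-oo, oo], with exp (-oo) = 0; the value at u = -oo is irrelevant. *)
definition exp_neg :: "ereal \<Rightarrow> real" where
  "exp_neg u = (if u = \<infinity> then 0 else exp (- real_of_ereal u))"

definition is_potential :: "'a measure \<Rightarrow> ('a \<Rightarrow> 'a \<Rightarrow> ereal) \<Rightarrow> bool" where
  "is_potential M \<phi> \<longleftrightarrow>
     (\<lambda>(x, y). \<phi> x y) \<in> borel_measurable (M \<Otimes>\<^sub>M M) \<and>
     (\<forall>x y. \<phi> x y = \<phi> y x) \<and> (\<forall>x y. \<phi> x y \<noteq> -\<infinity>)"

definition repulsive :: "('a \<Rightarrow> 'a \<Rightarrow> ereal) \<Rightarrow> bool" where
  "repulsive \<phi> \<longleftrightarrow> (\<forall>x y. 0 \<le> \<phi> x y)"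

definition temperedness_const :: "'a measure \<Rightarrow> ('a \<Rightarrow> 'a \<Rightarrow> ereal) \<Rightarrow> ennreal" where
  "temperedness_const M \<phi> = (SUP v. \<integral>\<^sup>+ x. ennreal \<bar>1 - exp_neg (\<phi> x v)\<bar> \<partial>M)"

definition tempered :: "'a measure \<Rightarrow> ('a \<Rightarrow> 'a \<Rightarrow> ereal) \<Rightarrow> bool" where
  "tempered M \<phi> \<longleftrightarrow> temperedness_const M \<phi> < \<infinity>"

definition homogeneous :: "'a::metric_space measure \<Rightarrow> ('a \<Rightarrow> 'a \<Rightarrow> ereal) \<Rightarrow> bool" where
  "homogeneous M \<phi> \<longleftrightarrow>
     (\<forall>x y. \<exists>g. bij g \<and> g x = y \<and>
        (\<forall>a b. dist (g a) (g b) = dist a b) \<and>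
        g \<in> measurable M M \<and> distr M M g = M \<and>
        (\<forall>a b. \<phi> (g a) (g b) = \<phi> a b))"

(*
  Functions on the disjoint union of the powers X^k, k \<ge> 1, are represented as functions on
  lists; their values at the empty list are irrelevant.  The power X^k with its product measure
  is PiM {..<k} (\<lambda>_. M), and tuple_of k turns its points into lists.
*)
definition tuple_of :: "nat \<Rightarrow> (nat \<Rightarrow> 'a) \<Rightarrow> 'a list" where
  "tuple_of k v = map v [0..<k]"

(* Measurability for the disjoint-union sigma-algebra, i.e. on each X^k separately. *)
definition measurable_on_tuples :: "'a measure \<Rightarrow> ('a list \<Rightarrow> real) \<Rightarrow> bool" where
  "measurable_on_tuples M f \<longleftrightarrow>
     (\<forall>k\<ge>1. (\<lambda>v. f (tuple_of k v)) \<in> borel_measurable (PiM {..<k} (\<lambda>_. M)))"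

definition damping_function :: "'a measure \<Rightarrow> ('a list \<Rightarrow> real) \<Rightarrow> bool" where
  "damping_function M \<gamma> \<longleftrightarrow>
     measurable_on_tuples M \<gamma> \<and>
     (\<forall>vs. vs \<noteq> [] \<longrightarrow> 0 \<le> \<gamma> vs \<and> \<gamma> vs \<le> 1) \<and>
     (\<forall>v. \<gamma> [v] = 1) \<and>
     (\<forall>v vs. vs \<noteq> [] \<longrightarrow> \<gamma> (v # vs) \<le> \<gamma> vs)"

(*
  Meant for repulsive potentials: the integrand is then nonnegative, and the integral is taken
  in [0, oo], with exp (-oo) = 0.
*)
definition tree_recursion ::
  "'a measure \<Rightarrow> ('a \<Rightarrow> 'a \<Rightarrow> ereal) \<Rightarrow> real \<Rightarrow> ('a list \<Rightarrow> real) \<Rightarrow> ('a list \<Rightarrow> real) \<Rightarrow> bool" where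
  "tree_recursion M \<phi> z \<gamma> \<pi> \<longleftrightarrow>
     0 \<le> z \<and> damping_function M \<gamma> \<and>
     measurable_on_tuples M \<pi> \<and>
     (\<forall>vs. vs \<noteq> [] \<longrightarrow> 0 \<le> \<pi> vs) \<and>
     (\<forall>j. AE v in PiM {..<Suc j} (\<lambda>_. M).
        \<pi> (tuple_of (Suc j) v) =
          z * \<gamma> (tuple_of (Suc j) v) *
          exp_neg (enn2ereal
            (\<integral>\<^sup>+ w. ennreal ((1 - exp_neg (\<phi> (v j) w)) * \<pi> (tuple_of (Suc j) v @ [w])) \<partial>M)))"

definition ae_equal_on_tuples ::
  "'a measure \<Rightarrow> ('a list \<Rightarrow> real) \<Rightarrow> ('a list \<Rightarrow> real) \<Rightarrow> bool" where
  "ae_equal_on_tuples M f g \<longleftrightarrow>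
     (\<forall>k\<ge>1. AE v in PiM {..<k} (\<lambda>_. M). f (tuple_of k v) = g (tuple_of k v))"

definition unit_damping :: "'a list \<Rightarrow> real" where
  "unit_damping = (\<lambda>_. 1)"

lemma damping_function_unit_damping: "damping_function M unit_damping"
  by (simp add: damping_function_def measurable_on_tuples_def unit_damping_def)

end

theory Submission
  imports Defs
begin

text \<open>By homogeneity the mass of \<open>1 - exp (- \<phi>(v, \<cdot>))\<close> does not depend on \<open>v\<close> and equals
  \<open>C = C\<^sub>\<phi>\<close>, so a function of the depth alone is a tree recursion as soon as consecutive values
  are related by \<open>f x = z exp (- C x)\<close>. The fixed point of \<open>f\<close> gives a constant recursion. If
  \<open>z C > e\<close>, the fixed point is repelling, \<open>f\<close> has a cycle of length two, and the two ways of
  alternating its values along the depth give different recursions. If \<open>z C < e\<close>, then \<open>f\<close> is a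
  contraction with factor \<open>sqrt (z C / e)\<close> in the metric \<open>\<bar>sqrt x - sqrt y\<bar>\<close>, because
  \<open>x exp (- C x) \<le> 1 / (e C)\<close>; one level of the recursion contracts the essential distance to the
  fixed point by the same factor.\<close>

section \<open>Fixed points, two-cycles and contraction of the scalar map
  \<open>f x = z * exp (- (C * x))\<close>\<close>

lemma fixed_point_exists:
  fixes z C :: real
  assumes "0 \<le> z" "0 \<le> C"
  obtains c where "0 \<le> c" "c = z * exp (- (C * c))"
proof -
  have "\<exists>x\<ge>0. x \<le> z \<and> x - z * exp (- (C * x)) = 0"
    using assms by (intro IVT') (auto intro!: continuous_intros mult_left_le)
  then show thesis
    using that by force
qed

text \<open>The second iterate of the map has derivative \<open>(C * c)\<^sup>2 > 1\<close> at the
  fixed point \<open>c\<close>. It therefore lies below the identity just left of \<open>c\<close>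
  but not at 0, and meets it at some \<open>a < c\<close>; \<open>b\<close> is the image of
  \<open>a\<close>.\<close>

lemma two_cycle_exists:
  fixes z C :: real
  assumes C: "0 < C" and zC: "exp 1 < z * C"
  obtains a b where "0 \<le> a" "a < b" "a = z * exp (- (C * b))" "b = z * exp (- (C * a))"
proof -
  have z: "0 < z"
    using C zC by (smt (verit) exp_gt_zero mult_nonpos_nonneg)
  obtain c where c: "0 \<le> c" "c = z * exp (- (C * c))"
    using fixed_point_exists[of z C] z C by auto
  have c0: "0 < c"
    using z by (subst c(2)) simp
  \<comment> \<open>The fixed point equation gives \<open>z * C = (C * c) * exp (C * c)\<close>,
    which is at most e when \<open>C * c \<le> 1\<close>.\<close>
  have Cc: "1 < C * c"
  proof (rule ccontr)
    assume *: "\<not> 1 < C * c"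
    have "c * exp (C * c) = z * exp (- (C * c)) * exp (C * c)"
      by (rule arg_cong[OF c(2), of "\<lambda>x. x * exp (C * c)"])
    also have "\<dots> = z"
      by (simp add: exp_minus)
    finally have "z * C = (C * c) * exp (C * c)"
      by simp
    also have "\<dots> \<le> 1 * exp 1"
      using * C c by (intro mult_mono) auto
    finally show False
      using zC by simp
  qed
  define g where "g x = z * exp (- (C * (z * exp (- (C * x))))) - x" for x
  have "(g has_real_derivative
          z * exp (- (C * (z * exp (- (C * c))))) * (C * (z * exp (- (C * c)) * C)) - 1) (at c)"
    unfolding g_def by (auto intro!: derivative_eq_intros)
  then have "(g has_real_derivative (C * c)\<^sup>2 - 1) (at c)"
    unfolding c(2)[symmetric] by (simp add: power2_eq_square algebra_simps)
  moreover have "0 < (C * c)\<^sup>2 - 1"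
    using Cc by (simp add: power2_eq_square less_1_mult)
  ultimately obtain d where d: "0 < d" "\<And>h. 0 < h \<Longrightarrow> h < d \<Longrightarrow> g (c - h) < g c"
    using DERIV_pos_inc_left by blast
  define h where "h = min d c / 2"
  have h: "0 < h" "h < d" "h < c"
    using d(1) c0 by (auto simp: h_def min_def)
  have "g c = 0"
    unfolding g_def c(2)[symmetric] by simp
  then have "g (c - h) \<le> 0"
    using d(2)[OF h(1,2)] by simp
  moreover have "0 \<le> g 0"
    using z by (simp add: g_def)
  moreover have "continuous_on {0..c - h} g"
    unfolding g_def by (intro continuous_intros)
  ultimately obtain a where a: "0 \<le> a" "a \<le> c - h" "g a = 0"
    using IVT2'[of g "c - h" 0 0] h by auto
  \<comment> \<open>The map is strictly decreasing and \<open>a < c\<close>, so the image of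
    \<open>a\<close> lies beyond \<open>c\<close> and the cycle does not degenerate.\<close>
  have "c < z * exp (- (C * a))"
    using a h z C by (subst c(2)) simp
  then show thesis
    using a h by (intro that[of a "z * exp (- (C * a))"]) (auto simp: g_def)
qed

text \<open>After passing to square roots the map becomes
  \<open>sqrt z * exp (- (C * s\<^sup>2) / 2)\<close>. Its squared derivative is
  \<open>z * C\<close> times \<open>u * exp (- u)\<close> with \<open>u = C * s\<^sup>2\<close>; the
  latter factor is at most 1/e, and the mean value inequality gives the Lipschitz constant.\<close>

lemma sqrt_contraction:
  fixes z C s t :: real
  assumes z: "0 \<le> z" and C: "0 \<le> C"
  shows "\<bar>sqrt (z * exp (- (C * s\<^sup>2))) - sqrt (z * exp (- (C * t\<^sup>2)))\<bar>
           \<le> sqrt (z * C / exp 1) * \<bar>s - t\<bar>"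
proof -
  define F where "F s = sqrt z * exp (- (C * s\<^sup>2) / 2)" for s :: real
  have F: "sqrt (z * exp (- (C * s\<^sup>2))) = F s" for s
  proof -
    have "exp (- (C * s\<^sup>2)) = (exp (- (C * s\<^sup>2) / 2))\<^sup>2"
      by (simp flip: exp_double)
    then show ?thesis
      by (simp add: F_def real_sqrt_mult)
  qed
  have "(F has_real_derivative - (C * s) * F s) (at s)" for s
    unfolding F_def by (auto intro!: derivative_eq_intros)
  moreover have "norm (- (C * s) * F s) \<le> sqrt (z * C / exp 1)" for s
  proof -
    have "C * s\<^sup>2 \<le> exp (C * s\<^sup>2 - 1)"
      using exp_ge_add_one_self[of "C * s\<^sup>2 - 1"] by simp
    then have *: "C * s\<^sup>2 * exp (- (C * s\<^sup>2)) \<le> 1 / exp 1"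
      by (simp add: exp_diff exp_minus field_simps)
    have "(- (C * s) * F s)\<^sup>2 = (C * s)\<^sup>2 * (z * exp (- (C * s\<^sup>2)))"
      using z by (simp add: F[symmetric] power_mult_distrib)
    also have "\<dots> = z * C * (C * s\<^sup>2 * exp (- (C * s\<^sup>2)))"
      by (simp add: power2_eq_square)
    also have "\<dots> \<le> z * C * (1 / exp 1)"
      using z C by (intro mult_left_mono *) auto
    finally show ?thesis
      using real_le_rsqrt[of "\<bar>- (C * s) * F s\<bar>"] by simp
  qed
  ultimately have "norm (F s - F t) \<le> sqrt (z * C / exp 1) * norm (s - t)"
    by (intro field_differentiable_bound[where S = UNIV and f' = "\<lambda>s. - (C * s) * F s"]) auto
  then show ?thesis
    by (simp add: F)
qed

section \<open>Bounds on \<open>exp_neg\<close>, slices of null sets, and invariance of integrals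
  under homogeneity\<close>

lemma exp_neg_ereal: "exp_neg (ereal u) = exp (- u)"
  by (simp add: exp_neg_def)

text \<open>An infinite \<open>x\<close> is covered, so the bound applies to an integral not yet
  known to be finite.\<close>

lemma exp_neg_le: "ennreal u \<le> x \<Longrightarrow> 0 \<le> u \<Longrightarrow> exp_neg (enn2ereal x) \<le> exp (- u)"
  by (cases x) (auto simp: exp_neg_def ennreal_le_iff2)

lemma exp_neg_ge: "x \<le> ennreal u \<Longrightarrow> 0 \<le> u \<Longrightarrow> exp (- u) \<le> exp_neg (enn2ereal x)"
  by (cases x) (auto simp: exp_neg_def top_unique ennreal_le_iff2)

lemma exp_neg_nonneg: "0 \<le> exp_neg u"
  by (simp add: exp_neg_def)

lemma exp_neg_le_1: "0 \<le> u \<Longrightarrow> exp_neg u \<le> 1"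
  by (cases u) (auto simp: exp_neg_def)

lemma borel_measurable_exp_neg [measurable]: "exp_neg \<in> borel_measurable borel"
  unfolding exp_neg_def[abs_def] by measurable

text \<open>By Tonelli, almost every slice of a null set is null. This turns a statement about
  almost all tuples into one about almost all children of almost all shorter tuples.\<close>

lemma (in product_sigma_finite) AE_PiM_insert:
  assumes I: "finite I" "i \<notin> I" and P: "AE x in Pi\<^sub>M (insert i I) M. P x"
  shows "AE x in Pi\<^sub>M I M. AE y in M i. P (x(i := y))"
proof -
  \<comment> \<open>The exceptional set of \<open>P\<close> may fail to be measurable; the argument
    runs on a measurable null set that covers it.\<close>
  obtain N where N: "{x \<in> space (Pi\<^sub>M (insert i I) M). \<not> P x} \<subseteq> N"
      "emeasure (Pi\<^sub>M (insert i I) M) N = 0" "N \<in> sets (Pi\<^sub>M (insert i I) M)"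
    using P by (rule AE_E)
  have ind [measurable]: "(indicator N :: _ \<Rightarrow> ennreal) \<in> borel_measurable (Pi\<^sub>M (insert i I) M)"
    using N(3) by simp
  have [measurable]:
    "(\<lambda>(x, y). indicator N (x(i := y)) :: ennreal) \<in> borel_measurable (Pi\<^sub>M I M \<Otimes>\<^sub>M M i)"
    using measurable_compose[OF measurable_add_dim ind] by (simp add: case_prod_beta')
  have "(\<integral>\<^sup>+ x. \<integral>\<^sup>+ y. indicator N (x(i := y)) \<partial>M i \<partial>Pi\<^sub>M I M) = 0"
    using product_nn_integral_insert[OF I ind] N(2,3) by simp
  moreover have "(\<lambda>x. \<integral>\<^sup>+ y. indicator N (x(i := y)) \<partial>M i) \<in> borel_measurable (Pi\<^sub>M I M)"
    by (rule M.borel_measurable_nn_integral) measurable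
  ultimately have "AE x in Pi\<^sub>M I M. (\<integral>\<^sup>+ y. indicator N (x(i := y)) \<partial>M i) = 0"
    by (simp add: nn_integral_0_iff_AE)
  then show ?thesis
  proof (rule AE_mp[OF _ AE_I2[OF impI]])
    fix x
    assume x: "x \<in> space (Pi\<^sub>M I M)" "(\<integral>\<^sup>+ y. indicator N (x(i := y)) \<partial>M i) = 0"
    have "(\<lambda>y. indicator N (x(i := y)) :: ennreal) \<in> borel_measurable (M i)"
      using measurable_compose[OF measurable_component_update[OF x(1) I(2)] ind] .
    then have "AE y in M i. (indicator N (x(i := y)) :: ennreal) = 0"
      using x(2) by (simp add: nn_integral_0_iff_AE)
    then show "AE y in M i. P (x(i := y))"
    proof (rule AE_mp[OF _ AE_I2[OF impI]])
      fix y
      assume y: "y \<in> space (M i)" "(indicator N (x(i := y)) :: ennreal) = 0"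
      have "x(i := y) \<in> space (Pi\<^sub>M (insert i I) M)"
        using x(1) y(1) by (auto simp: space_PiM PiE_iff extensional_def)
      then show "P (x(i := y))"
        using N(1) y(2) by (auto simp: indicator_eq_0_iff)
    qed
  qed
qed

lemma locally_finite_sigma_finite:
  assumes M: "sets M = sets borel" and fin: "locally_finite M"
  shows "sigma_finite_measure M"
proof
  have "emeasure M (ball x r) < \<infinity>" for x :: 'a and r
    using fin by (simp add: locally_finite_def)
  moreover have "(\<Union>n. ball x (real n)) = space M" for x :: 'a
    using reals_Archimedean2 sets_eq_imp_space_eq[OF M] by auto
  ultimately show "\<exists>A. countable A \<and> A \<subseteq> sets M \<and> \<Union> A = space M \<and> (\<forall>a\<in>A. emeasure M a \<noteq> \<infinity>)"
    by (intro exI[of _ "range (\<lambda>n. ball undefined (real n))"]) (auto simp: M less_top)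
qed

text \<open>Change variables by the measure-preserving bijection that carries \<open>v\<close> to
  \<open>w\<close>; invariance of \<open>\<phi>\<close> restores the integrand.\<close>

lemma homogeneous_nn_integral_eq:
  assumes M: "space M = UNIV" and hom: "homogeneous M \<phi>"
    and f: "\<And>y. (\<lambda>x. f (\<phi> x y)) \<in> borel_measurable M"
  shows "(\<integral>\<^sup>+ x. f (\<phi> x v) \<partial>M) = (\<integral>\<^sup>+ x. f (\<phi> x w) \<partial>M)"
proof -
  obtain g where g: "g v = w" "g \<in> measurable M M" "distr M M g = M"
      "\<And>a b. \<phi> (g a) (g b) = \<phi> a b"
    using hom unfolding homogeneous_def by metis
  have "(\<integral>\<^sup>+ x. f (\<phi> x w) \<partial>M) = (\<integral>\<^sup>+ x. f (\<phi> x w) \<partial>distr M M g)"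
    by (simp add: g(3))
  also have "\<dots> = (\<integral>\<^sup>+ x. f (\<phi> (g x) (g v)) \<partial>M)"
    using f by (simp add: nn_integral_distr g(1,2))
  finally show ?thesis
    by (simp add: g(4))
qed

lemma tuple_of_Suc_upd: "tuple_of (Suc k) (v(k := w)) = tuple_of k v @ [w]"
  by (simp add: tuple_of_def)

lemma length_tuple_of [simp]: "length (tuple_of k v) = k"
  by (simp add: tuple_of_def)

section \<open>Tree recursions over a kernel whose slices all have mass \<open>C\<close>\<close>

locale constant_kernel_mass = sigma_finite_measure M
  for M :: "'a measure" and \<phi> :: "'a \<Rightarrow> 'a \<Rightarrow> ereal" +
  fixes C :: real
  assumes kernel_measurable: "\<And>v. (\<lambda>w. 1 - exp_neg (\<phi> v w)) \<in> borel_measurable M"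
    and kernel_nonneg: "\<And>v w. 0 \<le> 1 - exp_neg (\<phi> v w)"
    and mass_nonneg: "0 \<le> C"
    and kernel_mass: "\<And>v. (\<integral>\<^sup>+ w. ennreal (1 - exp_neg (\<phi> v w)) \<partial>M) = ennreal C"
begin

lemma nn_integral_kernel_const:
  assumes "0 \<le> a"
  shows "(\<integral>\<^sup>+ w. ennreal ((1 - exp_neg (\<phi> v w)) * a) \<partial>M) = ennreal (C * a)"
  using assms kernel_measurable[of v]
  by (simp add: ennreal_mult[OF kernel_nonneg] ennreal_mult[OF mass_nonneg] nn_integral_multc kernel_mass)

text \<open>All children of a tuple share one value, so the integral is \<open>C\<close> times that
  value and only the relation between consecutive depths remains.\<close>

lemma depth_tree_recursion:
  assumes z: "0 \<le> z" and s0: "\<And>n. 0 \<le> s n" and s: "\<And>n. s n = z * exp (- (C * s (Suc n)))"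
  shows "tree_recursion M \<phi> z unit_damping (\<lambda>vs. s (length vs))"
  unfolding tree_recursion_def
proof (intro conjI allI impI)
  fix j
  show "AE v in PiM {..<Suc j} (\<lambda>_. M). s (length (tuple_of (Suc j) v)) =
      z * unit_damping (tuple_of (Suc j) v) *
      exp_neg (enn2ereal (\<integral>\<^sup>+ w. ennreal ((1 - exp_neg (\<phi> (v j) w)) *
        s (length (tuple_of (Suc j) v @ [w]))) \<partial>M))"
    using s[of "Suc j"] s0 mass_nonneg
    by (simp add: unit_damping_def nn_integral_kernel_const exp_neg_ereal)
qed (use z s0 in \<open>auto simp: damping_function_unit_damping measurable_on_tuples_def\<close>)

text \<open>The output decreases as the children grow, so it lies between the outputs for the
  constant values \<open>hi\<^sup>2\<close> and \<open>lo\<^sup>2\<close>. Both of these are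
  controlled by \<open>sqrt_contraction\<close>, compared with the fixed point.\<close>

lemma recursion_step_contracts:
  assumes z: "0 \<le> z" and c: "0 \<le> c" "c = z * exp (- (C * c))" and r: "0 \<le> r"
    and p0: "\<And>w. 0 \<le> p w" and p: "AE w in M. \<bar>sqrt (p w) - sqrt c\<bar> \<le> r"
  shows "\<bar>sqrt (z * exp_neg (enn2ereal (\<integral>\<^sup>+ w. ennreal ((1 - exp_neg (\<phi> v w)) * p w) \<partial>M))) - sqrt c\<bar>
           \<le> sqrt (z * C / exp 1) * r"
proof -
  define q where "q = sqrt (z * C / exp 1)"
  \<comment> \<open>Cutting \<open>lo\<close> off at 0 keeps squaring monotone; its distance from
    \<open>sqrt c\<close> stays at most \<open>r\<close> because \<open>sqrt c\<close> is
    nonnegative.\<close>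
  define lo hi where "lo = max 0 (sqrt c - r)" and "hi = sqrt c + r"
  define J where "J = (\<integral>\<^sup>+ w. ennreal ((1 - exp_neg (\<phi> v w)) * p w) \<partial>M)"
  have q: "0 \<le> q"
    using z mass_nonneg by (simp add: q_def)
  have bounds: "0 \<le> lo" "0 \<le> hi" "\<bar>lo - sqrt c\<bar> \<le> r" "\<bar>hi - sqrt c\<bar> \<le> r"
    using c(1) r by (auto simp: lo_def hi_def)
  have contr: "\<bar>sqrt (z * exp (- (C * s\<^sup>2))) - sqrt c\<bar> \<le> q * r" if "\<bar>s - sqrt c\<bar> \<le> r" for s
  proof -
    have "sqrt c = sqrt (z * exp (- (C * (sqrt c)\<^sup>2)))"
      using c(1) by (simp flip: c(2))
    then have "\<bar>sqrt (z * exp (- (C * s\<^sup>2))) - sqrt c\<bar> \<le> q * \<bar>s - sqrt c\<bar>"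
      using sqrt_contraction[OF z mass_nonneg, of s "sqrt c"] by (simp add: q_def)
    also have "\<dots> \<le> q * r"
      using that q by (rule mult_left_mono)
    finally show ?thesis .
  qed
  have sq: "lo\<^sup>2 \<le> x \<and> x \<le> hi\<^sup>2" if "0 \<le> x" "\<bar>sqrt x - sqrt c\<bar> \<le> r" for x
  proof -
    have "lo \<le> sqrt x" "sqrt x \<le> hi"
      using that by (auto simp: lo_def hi_def)
    then have "lo\<^sup>2 \<le> (sqrt x)\<^sup>2" "(sqrt x)\<^sup>2 \<le> hi\<^sup>2"
      using bounds(1) that(1) by (simp_all only: power_mono real_sqrt_ge_zero)
    then show ?thesis
      using that by simp
  qed
  have "AE w in M. ennreal ((1 - exp_neg (\<phi> v w)) * lo\<^sup>2) \<le> ennreal ((1 - exp_neg (\<phi> v w)) * p w)"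
      "AE w in M. ennreal ((1 - exp_neg (\<phi> v w)) * p w) \<le> ennreal ((1 - exp_neg (\<phi> v w)) * hi\<^sup>2)"
    using p by (eventually_elim, intro ennreal_leI mult_left_mono kernel_nonneg, simp add: sq p0)+
  then have "(\<integral>\<^sup>+ w. ennreal ((1 - exp_neg (\<phi> v w)) * lo\<^sup>2) \<partial>M) \<le> J"
      "J \<le> (\<integral>\<^sup>+ w. ennreal ((1 - exp_neg (\<phi> v w)) * hi\<^sup>2) \<partial>M)"
    unfolding J_def by (blast intro: nn_integral_mono_AE)+
  then have "ennreal (C * lo\<^sup>2) \<le> J" "J \<le> ennreal (C * hi\<^sup>2)"
    by (simp_all add: nn_integral_kernel_const)
  then have "exp_neg (enn2ereal J) \<le> exp (- (C * lo\<^sup>2))" "exp (- (C * hi\<^sup>2)) \<le> exp_neg (enn2ereal J)"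
    using mass_nonneg by (auto intro!: exp_neg_le exp_neg_ge)
  then have "sqrt (z * exp_neg (enn2ereal J)) \<le> sqrt (z * exp (- (C * lo\<^sup>2)))"
      "sqrt (z * exp (- (C * hi\<^sup>2))) \<le> sqrt (z * exp_neg (enn2ereal J))"
    using z by (auto intro!: mult_left_mono)
  then show ?thesis
    using contr[OF bounds(3)] contr[OF bounds(4)] unfolding J_def q_def by linarith
qed

text \<open>Induction on \<open>n\<close> for all depths at once: each further factor is gained from
  the bound one level deeper.\<close>

lemma tree_recursion_AE_near_fixed_point:
  assumes rec: "tree_recursion M \<phi> z unit_damping \<pi>"
    and c: "0 \<le> c" "c = z * exp (- (C * c))"
  shows "AE v in PiM {..<Suc j} (\<lambda>_. M).
    \<bar>sqrt (\<pi> (tuple_of (Suc j) v)) - sqrt c\<bar> \<le> sqrt (z * C / exp 1) ^ n * sqrt z"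
proof -
  have z: "0 \<le> z" and \<pi>0: "\<And>vs. vs \<noteq> [] \<Longrightarrow> 0 \<le> \<pi> vs"
    and eq: "\<And>j. AE v in PiM {..<Suc j} (\<lambda>_. M). \<pi> (tuple_of (Suc j) v) =
      z * exp_neg (enn2ereal
        (\<integral>\<^sup>+ w. ennreal ((1 - exp_neg (\<phi> (v j) w)) * \<pi> (tuple_of (Suc j) v @ [w])) \<partial>M))"
    using rec by (simp_all add: tree_recursion_def unit_damping_def)
  interpret P: product_sigma_finite "\<lambda>_::nat. M"
    by unfold_locales
  show ?thesis
  proof (induction n arbitrary: j)
    case 0
    \<comment> \<open>Both square roots lie between 0 and \<open>sqrt z\<close>, whatever the
      integral is.\<close>
    have near: "\<bar>sqrt (z * exp_neg (enn2ereal J)) - sqrt c\<bar> \<le> sqrt z" for J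
    proof -
      have "c \<le> z"
        using z c(1) mass_nonneg by (subst c(2)) (simp add: mult_left_le)
      then have "sqrt (z * exp_neg (enn2ereal J)) \<le> sqrt z" "sqrt c \<le> sqrt z"
        using z by (auto intro!: mult_left_le exp_neg_le_1)
      moreover have "0 \<le> sqrt (z * exp_neg (enn2ereal J))" "0 \<le> sqrt c"
        using z c(1) by (simp_all add: exp_neg_nonneg)
      ultimately show ?thesis
        by linarith
    qed
    show ?case
      using eq[of j] by eventually_elim (simp add: near)
  next
    case (Suc n)
    \<comment> \<open>The child is the coordinate with index \<open>Suc j\<close>; slicing the
      induction hypothesis at depth \<open>Suc j\<close> along it separates child from
      parent.\<close>
    have "AE v in PiM {..<Suc j} (\<lambda>_. M). AE w in M.
        \<bar>sqrt (\<pi> (tuple_of (Suc j) v @ [w])) - sqrt c\<bar> \<le> sqrt (z * C / exp 1) ^ n * sqrt z"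
      using P.AE_PiM_insert[OF _ _ Suc.IH[of "Suc j", unfolded lessThan_Suc[of "Suc j"]]]
      by (simp add: tuple_of_Suc_upd del: fun_upd_apply)
    then show ?case
      using eq[of j]
    proof eventually_elim
      case (elim v)
      have "0 \<le> sqrt (z * C / exp 1) ^ n * sqrt z"
        using z mass_nonneg by simp
      from recursion_step_contracts[OF z c this _ elim(1), of "v j"] \<pi>0 show ?case
        by (simp add: elim(2) mult.assoc)
    qed
  qed
qed

lemma tree_recursion_unique:
  assumes rec: "tree_recursion M \<phi> z unit_damping \<pi>"
    and c: "0 \<le> c" "c = z * exp (- (C * c))" and zC: "z * C < exp 1"
  shows "ae_equal_on_tuples M (\<lambda>_. c) \<pi>"
  unfolding ae_equal_on_tuples_def
proof (intro allI impI)
  fix k :: nat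
  assume "1 \<le> k"
  then obtain j where k: "k = Suc j"
    by (cases k) auto
  have z: "0 \<le> z"
    using rec by (simp add: tree_recursion_def)
  have "(\<lambda>n. sqrt (z * C / exp 1) ^ n * sqrt z) \<longlonglongrightarrow> 0 * sqrt z"
    using z mass_nonneg zC by (intro tendsto_mult LIMSEQ_realpow_zero tendsto_const) auto
  then have lim: "(\<lambda>n. sqrt (z * C / exp 1) ^ n * sqrt z) \<longlonglongrightarrow> 0"
    by simp
  \<comment> \<open>There are countably many exponents, so one null set serves them all.\<close>
  have "AE v in PiM {..<k} (\<lambda>_. M). \<forall>n.
      \<bar>sqrt (\<pi> (tuple_of k v)) - sqrt c\<bar> \<le> sqrt (z * C / exp 1) ^ n * sqrt z"
    unfolding AE_all_countable k using tree_recursion_AE_near_fixed_point[OF rec c] by blast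
  then show "AE v in PiM {..<k} (\<lambda>_. M). c = \<pi> (tuple_of k v)"
  proof eventually_elim
    case (elim v)
    have "\<bar>sqrt (\<pi> (tuple_of k v)) - sqrt c\<bar> \<le> 0"
      using elim by (intro LIMSEQ_le_const[OF lim]) auto
    then show ?case
      by simp
  qed
qed

text \<open>The two functions differ at every tuple, so equality almost everywhere would make
  \<open>M\<close> the null measure, against the positive kernel mass.\<close>

lemma alternating_not_ae_equal:
  assumes C: "0 < C" and ab: "a \<noteq> b"
  shows "\<not> ae_equal_on_tuples M (\<lambda>vs. if odd (length vs) then a else b)
             (\<lambda>vs. if odd (length vs) then b else a)"
proof
  assume "ae_equal_on_tuples M (\<lambda>vs. if odd (length vs) then a else b)
             (\<lambda>vs. if odd (length vs) then b else a)"
  \<comment> \<open>Tuples of size 1 suffice, since the one-factor product has the total mass of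
    \<open>M\<close>.\<close>
  then have "AE v in PiM {..<1::nat} (\<lambda>_. M). False"
    using ab unfolding ae_equal_on_tuples_def by (auto dest!: spec[of _ 1])
  then have "emeasure (PiM {..<1::nat} (\<lambda>_. M)) (space (PiM {..<1} (\<lambda>_. M))) = 0"
    by (simp add: AE_iff_measurable[OF sets.top])
  moreover interpret P: product_sigma_finite "\<lambda>_::nat. M"
    by unfold_locales
  have "emeasure (PiM {..<1::nat} (\<lambda>_. M)) (space (PiM {..<1} (\<lambda>_. M))) = emeasure M (space M)"
    by (simp add: space_PiM P.emeasure_PiM)
  ultimately have "AE w in M. False"
    by (simp add: AE_iff_measurable[OF sets.top])
  then have "(\<integral>\<^sup>+ w. ennreal (1 - exp_neg (\<phi> v w)) \<partial>M) = (\<integral>\<^sup>+ w. 0 \<partial>M)" for v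
    by (intro nn_integral_cong_AE) (auto elim!: eventually_mono)
  then show False
    using C by (simp add: kernel_mass)
qed

end

section \<open>From homogeneity to constant kernel mass, and the two sides of the threshold\<close>

theorem theorem29:
  fixes \<mu> :: "'a::polish_space measure"
    and \<phi> :: "'a \<Rightarrow> 'a \<Rightarrow> ereal"
  assumes sets_mu: "sets \<mu> = sets borel"
    and locally_finite: "locally_finite \<mu>"
    and distances_ac: "\<And>x. absolutely_continuous (restrict_space lborel {0..})
           (distr \<mu> (restrict_space borel {0..}) (\<lambda>y. dist y x))"
    and potential: "is_potential \<mu> \<phi>"
    and repulsive: "repulsive \<phi>"
    and tempered: "tempered \<mu> \<phi>"
    and homogeneous: "homogeneous \<mu> \<phi>"
  shows "(\<forall>z\<ge>0. \<exists>\<pi>. tree_recursion \<mu> \<phi> z unit_damping \<pi>) \<and>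
    (\<forall>z\<ge>0. ennreal z < ennreal (exp 1) / temperedness_const \<mu> \<phi> \<longrightarrow>
       (\<exists>\<pi>. tree_recursion \<mu> \<phi> z unit_damping \<pi> \<and>
         (\<forall>\<pi>'. tree_recursion \<mu> \<phi> z unit_damping \<pi>' \<longrightarrow> ae_equal_on_tuples \<mu> \<pi> \<pi>'))) \<and>
    (\<forall>z\<ge>0. ennreal z > ennreal (exp 1) / temperedness_const \<mu> \<phi> \<longrightarrow>
       (\<exists>\<pi> \<pi>'. tree_recursion \<mu> \<phi> z unit_damping \<pi> \<and>
         tree_recursion \<mu> \<phi> z unit_damping \<pi>' \<and> \<not> ae_equal_on_tuples \<mu> \<pi> \<pi>'))"
proof -
  have space: "space \<mu> = UNIV"
    using sets_eq_imp_space_eq[OF sets_mu] by simp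
  have sym: "\<phi> x y = \<phi> y x" for x y
    using potential by (simp add: is_potential_def)
  have pm: "(\<lambda>(x, y). \<phi> x y) \<in> borel_measurable (\<mu> \<Otimes>\<^sub>M \<mu>)"
    using potential by (simp add: is_potential_def)
  have [measurable]: "(\<lambda>y. \<phi> x y) \<in> borel_measurable \<mu>" for x
    using measurable_compose[OF measurable_Pair1'[of x \<mu> \<mu>] pm] space by simp
  then have [measurable]: "(\<lambda>y. \<phi> y x) \<in> borel_measurable \<mu>" for x
    by (simp add: sym[of _ x])
  have nonneg: "0 \<le> 1 - exp_neg (\<phi> x y)" for x y
    using repulsive by (simp add: repulsive_def exp_neg_le_1)
  define m where "m v = (\<integral>\<^sup>+ x. ennreal \<bar>1 - exp_neg (\<phi> x v)\<bar> \<partial>\<mu>)" for v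
  have m: "m v = m w" for v w
    unfolding m_def
    by (rule homogeneous_nn_integral_eq[OF space homogeneous, where f = "\<lambda>u. ennreal \<bar>1 - exp_neg u\<bar>"])
       measurable
  have C_eq_m: "temperedness_const \<mu> \<phi> = m v" for v
  proof -
    have "temperedness_const \<mu> \<phi> = (SUP w. m w)"
      by (simp add: temperedness_const_def m_def)
    also have "\<dots> = (SUP w::'a. m v)"
      by (rule SUP_cong[OF refl m])
    finally show ?thesis
      by simp
  qed
  obtain C where C: "0 \<le> C" "temperedness_const \<mu> \<phi> = ennreal C"
    using tempered unfolding tempered_def by (cases "temperedness_const \<mu> \<phi>") auto
  interpret constant_kernel_mass \<mu> \<phi> C
  proof (intro constant_kernel_mass.intro constant_kernel_mass_axioms.intro)
    show "sigma_finite_measure \<mu>"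
      by (rule locally_finite_sigma_finite[OF sets_mu locally_finite])
    \<comment> \<open>Symmetry moves the integration variable from the first argument of
      \<open>\<phi>\<close>, as in \<open>temperedness_const\<close>, to the second, as in the
      recursion.\<close>
    show "(\<integral>\<^sup>+ w. ennreal (1 - exp_neg (\<phi> v w)) \<partial>\<mu>) = ennreal C" for v
      using C_eq_m[of v] C(2) nonneg by (simp add: m_def sym[of v])
    show "(\<lambda>w. 1 - exp_neg (\<phi> v w)) \<in> borel_measurable \<mu>" for v
      by measurable
  qed (fact nonneg C(1))+
  have const: "\<exists>c. 0 \<le> c \<and> c = z * exp (- (C * c)) \<and> tree_recursion \<mu> \<phi> z unit_damping (\<lambda>_. c)"
    if z: "0 \<le> z" for z
  proof -
    obtain c where c: "0 \<le> c" "c = z * exp (- (C * c))"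
      using fixed_point_exists[OF z C(1)] .
    then show ?thesis
      using depth_tree_recursion[of z "\<lambda>_. c"] z by blast
  qed
  \<comment> \<open>In \<open>ennreal\<close> a positive number over 0 is \<open>top\<close>: for
    \<open>C = 0\<close> the uniqueness claim covers every \<open>z\<close> and the nonuniqueness
    claim is vacuous.\<close>
  have quotient: "ennreal (exp 1) / temperedness_const \<mu> \<phi> =
      (if C = 0 then top else ennreal (exp 1 / C))"
    using C by (simp add: divide_ennreal ennreal_divide_eq_top_iff)
  show ?thesis
  proof (intro conjI allI impI)
    fix z :: real
    assume "0 \<le> z"
    then show "\<exists>\<pi>. tree_recursion \<mu> \<phi> z unit_damping \<pi>"
      using const by blast
  next
    fix z :: real
    assume z: "0 \<le> z" "ennreal z < ennreal (exp 1) / temperedness_const \<mu> \<phi>"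
    have "z * C < exp 1"
      using z C(1) by (cases "C = 0") (auto simp: quotient ennreal_less_iff field_simps)
    then show "\<exists>\<pi>. tree_recursion \<mu> \<phi> z unit_damping \<pi> \<and>
        (\<forall>\<pi>'. tree_recursion \<mu> \<phi> z unit_damping \<pi>' \<longrightarrow> ae_equal_on_tuples \<mu> \<pi> \<pi>')"
      using const[OF z(1)] tree_recursion_unique by blast
  next
    fix z :: real
    assume z: "0 \<le> z" "ennreal z > ennreal (exp 1) / temperedness_const \<mu> \<phi>"
    have C0: "0 < C"
      using z C(1) by (cases "C = 0") (auto simp: quotient)
    then have "exp 1 < z * C"
      using z by (auto simp: quotient ennreal_less_iff field_simps)
    then obtain a b where ab: "0 \<le> a" "a < b" "a = z * exp (- (C * b))" "b = z * exp (- (C * a))"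
      using two_cycle_exists[OF C0] by blast
    have "tree_recursion \<mu> \<phi> z unit_damping (\<lambda>vs. if odd (length vs) then a else b)"
      by (rule depth_tree_recursion[of z "\<lambda>n. if odd n then a else b"]) (use z ab(1,2) in \<open>auto simp flip: ab(3,4)\<close>)
    moreover have "tree_recursion \<mu> \<phi> z unit_damping (\<lambda>vs. if odd (length vs) then b else a)"
      by (rule depth_tree_recursion[of z "\<lambda>n. if odd n then b else a"]) (use z ab(1,2) in \<open>auto simp flip: ab(3,4)\<close>)
    ultimately show "\<exists>\<pi> \<pi>'. tree_recursion \<mu> \<phi> z unit_damping \<pi> \<and>
        tree_recursion \<mu> \<phi> z unit_damping \<pi>' \<and> \<not> ae_equal_on_tuples \<mu> \<pi> \<pi>'"
      using alternating_not_ae_equal[OF C0, of a b] ab(2) by blast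
  qed
qed

end
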